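(* Let $d \le \omega$, let $X_m$ be a dense-in-itself Polish space for each $m \in d$, and let $Y$ be a metric space. If $f \colon \prod_{m \in d} X_m \to Y$ is $(s^d)$-measurable, then for any perfect $d$-cube $P = \prod_{m \in d} P_m$ there exists a perfect $d$-cube $Q \subseteq P$ such that $f|_Q$ is continuous.
   Context: Here $d \le \omega$ is a natural number or $\omega$, identified with the set $\{m : m < d\}$. A perfect subset of $X_m$ is a non-empty closed subset without isolated points. A perfect $d$-cube is a set $P = \prod_{m \in d} P_m$ where every $P_m \subseteq X_m$ is perfect. A set $A \subseteq \prod_{m \in d} X_m$ has the $(s^d)$-property (written $A \in s^d$) if for every perfect $d$-cube $P$ there is a perfect $d$-cube $Q \subseteq P$ such that $Q \subseteq A$ or $Q \subseteq \prod_{m \in d} X_m \setminus A$. A function $f \colon \prod_{m\in d} X_m \to Y$ into a metric space is $(s^d)$-measurable if $f^{-1}(U) \in s^d$ for every open $U \subseteq Y$. Continuity of $f|_Q$ refers to the subspace topology on $Q$ inherited from the product topology. *)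

theory Defs
  imports "HOL-Analysis.Analysis" "HOL-Library.Extended_Nat"
begin

definition Polish_space :: "'a topology \<Rightarrow> bool" where
  "Polish_space X \<longleftrightarrow> completely_metrizable_space X \<and> separable_space X"

definition dense_in_itself :: "'a topology \<Rightarrow> bool" where
  "dense_in_itself X \<longleftrightarrow> (\<forall>x\<in>topspace X. \<not> openin X {x})"

definition perfect_in :: "'a topology \<Rightarrow> 'a set \<Rightarrow> bool" where
  "perfect_in X P \<longleftrightarrow> closedin X P \<and> P \<noteq> {} \<and> dense_in_itself (subtopology X P)"

(* d <= omega is an enat, with the value infinity playing the role of omega;
   index_set d is the set of natural numbers that d is identified with. *)
definition index_set :: "enat \<Rightarrow> nat set" where
  "index_set d = {m. enat m < d}"

(* All X m live in one type, but each has its own carrier topspace (X m), so the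
   factors may be unrelated spaces. *)
definition cube_topology :: "enat \<Rightarrow> (nat \<Rightarrow> 'a topology) \<Rightarrow> (nat \<Rightarrow> 'a) topology" where
  "cube_topology d X = product_topology X (index_set d)"

definition perfect_cube :: "enat \<Rightarrow> (nat \<Rightarrow> 'a topology) \<Rightarrow> (nat \<Rightarrow> 'a) set \<Rightarrow> bool" where
  "perfect_cube d X P \<longleftrightarrow>
     (\<exists>F. (\<forall>m\<in>index_set d. perfect_in (X m) (F m)) \<and> P = Pi\<^sub>E (index_set d) F)"

definition s_sets :: "enat \<Rightarrow> (nat \<Rightarrow> 'a topology) \<Rightarrow> (nat \<Rightarrow> 'a) set set" where
  "s_sets d X = {A. A \<subseteq> topspace (cube_topology d X) \<and>
     (\<forall>P. perfect_cube d X P \<longrightarrow>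
       (\<exists>Q. perfect_cube d X Q \<and> Q \<subseteq> P \<and>
            (Q \<subseteq> A \<or> Q \<subseteq> topspace (cube_topology d X) - A)))}"

definition s_measurable ::
  "enat \<Rightarrow> (nat \<Rightarrow> 'a topology) \<Rightarrow> 'b topology \<Rightarrow> ((nat \<Rightarrow> 'a) \<Rightarrow> 'b) \<Rightarrow> bool" where
  "s_measurable d X Y f \<longleftrightarrow>
     f \<in> topspace (cube_topology d X) \<rightarrow> topspace Y \<and>
     (\<forall>U. openin Y U \<longrightarrow> {x \<in> topspace (cube_topology d X). f x \<in> U} \<in> s_sets d X)"

end

theory Submission
  imports Defs
begin

text \<open>
  The idea is to find, below every perfect cube and for every \<open>e > 0\<close>, a perfect subcube whose
  image under \<open>f\<close> lies in a ball of radius \<open>e\<close>, and then to combine countably many such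
  refinements by fusion.

  \<^emph>\<open>Fusion\<close> (\<open>fusion\<close>) says that countably many hereditary properties, each attainable on a
  subcube of any given cube, hold locally on one and the same perfect cube. Its sides are kernels
  of Cantor schemes. At each stage only finitely many coordinates have been split, so the stage
  consists of finitely many cubes, which are refined one after another. Applied to the properties
  of having an image in a ball of radius \<open>1 / (n + 1)\<close>, fusion yields continuity. It also shows
  that if countably many sets with the \<open>s\<close>-property cover a cube, then one of them contains a
  perfect subcube (\<open>countable_cover_contains_cube\<close>); for separable \<open>Y\<close> a countable cover of \<open>Y\<close>
  by balls would then provide the small images.

  For an arbitrary metric space \<open>Y\<close>, cover \<open>Y\<close> instead by countably many layers of disjoint small
  open sets (\<open>sigma_discrete_cover\<close>). On a perfect cube \<open>R\<close> inside the preimage of one layer, let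
  \<open>g x\<close> be the name of the set of the layer that contains \<open>f x\<close>. Every union of sets of the layer
  is open, so the preimage under \<open>g\<close> of \<^emph>\<open>every\<close> set of names is decided on subcubes of \<open>R\<close>, and it
  remains to see that such a \<open>g\<close> is constant on some subcube (\<open>constant_on_subcube\<close>). Suppose it
  is not. There are at most continuum many names that occur, so they can be coded by sets of
  naturals, and fusion over the bits of the code shows that every subcube contains two subcubes
  with disjoint \<open>g\<close>-images (\<open>cube_split_values\<close>). Hence \<open>g\<close> takes continuum many values on every
  subcube. As there are only continuum many cubes, a Bernstein-type set of names (\<open>bernstein_set\<close>)
  meets the image of every subcube without including it, so its preimage is not decided.
\<close>

section \<open>Perfect sets in regular and in complete metric spaces\<close>

lemma perfect_in_iff:
  "perfect_in X P \<longleftrightarrow> closedin X P \<and> P \<noteq> {} \<and>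
     (\<forall>x\<in>P. \<forall>U. openin X U \<and> x \<in> U \<longrightarrow> (\<exists>y\<in>P \<inter> U. y \<noteq> x))"
proof -
  have "dense_in_itself (subtopology X P) \<longleftrightarrow>
      (\<forall>x\<in>P. \<forall>U. openin X U \<and> x \<in> U \<longrightarrow> (\<exists>y\<in>P \<inter> U. y \<noteq> x))" if "P \<subseteq> topspace X"
    using that unfolding dense_in_itself_def openin_subtopology by auto blast+
  then show ?thesis
    unfolding perfect_in_def using closedin_subset by blast
qed

lemma perfect_in_subset_topspace: "perfect_in X P \<Longrightarrow> P \<subseteq> topspace X"
  by (simp add: perfect_in_def closedin_subset)

lemma perfect_in_nonempty: "perfect_in X P \<Longrightarrow> P \<noteq> {}"
  by (simp add: perfect_in_def)

text \<open>
  The closure of a relatively open piece of \<open>P\<close> has no isolated points, because every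
  neighbourhood of a point of the closure already contains two points of the piece. Regularity
  lets the piece be chosen so small that its closure stays inside \<open>U\<close>.
\<close>

lemma perfect_in_open_piece:
  assumes X: "regular_space X" and P: "perfect_in X P"
    and U: "openin X U" "x \<in> P" "x \<in> U"
  obtains P' where "perfect_in X P'" "P' \<subseteq> P \<inter> U"
proof -
  obtain V C where V: "openin X V" "closedin X C" "x \<in> V" "V \<subseteq> C" "C \<subseteq> U"
    using X U unfolding neighbourhood_base_of_closedin [symmetric] neighbourhood_base_of
    by meson
  have PX: "P \<subseteq> topspace X" using P by (rule perfect_in_subset_topspace)
  let ?P' = "X closure_of (P \<inter> V)"
  have PV: "P \<inter> V \<subseteq> ?P'" using PX by (simp add: closure_of_subset le_infI1)
  have "perfect_in X ?P'"
    unfolding perfect_in_iff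
  proof (intro conjI ballI allI impI)
    show "closedin X ?P'" by simp
    show "?P' \<noteq> {}" using PV U(2) V(3) by blast
    fix y W assume y: "y \<in> ?P'" and W: "openin X W \<and> y \<in> W"
    obtain z where z: "z \<in> P \<inter> V" "z \<in> W"
      using y W unfolding in_closure_of by blast
    have "openin X (V \<inter> W)" using V(1) W by blast
    then obtain z' where "z' \<in> P \<inter> (V \<inter> W)" "z' \<noteq> z"
      using P z unfolding perfect_in_iff by (metis IntD1 IntD2 IntI)
    then show "\<exists>u\<in>?P' \<inter> W. u \<noteq> y" using z PV by (cases "z = y") blast+
  qed
  moreover have "?P' \<subseteq> P \<inter> C"
    using P V closure_of_minimal[of "P \<inter> V" "P \<inter> C" X] by (auto simp: perfect_in_def)
  ultimately show thesis using that V(5) by blast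
qed

lemma perfect_in_split:
  assumes X: "regular_space X" "Hausdorff_space X" and P: "perfect_in X P"
  obtains A B where "perfect_in X A" "perfect_in X B" "A \<subseteq> P" "B \<subseteq> P" "A \<inter> B = {}"
proof -
  obtain x where x: "x \<in> P" using P perfect_in_nonempty by blast
  moreover have "x \<in> topspace X" using x P perfect_in_subset_topspace by blast
  ultimately obtain y where y: "y \<in> P" "y \<noteq> x"
    using P openin_topspace unfolding perfect_in_iff by blast
  obtain U V where "openin X U" "openin X V" "x \<in> U" "y \<in> V" "disjnt U V"
    using X(2) x y perfect_in_subset_topspace[OF P] unfolding Hausdorff_space_def by (metis subsetD)
  moreover from this obtain A B where "perfect_in X A" "A \<subseteq> P \<inter> U" "perfect_in X B" "B \<subseteq> P \<inter> V"
    using x y perfect_in_open_piece[OF X(1) P] by metis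
  ultimately show thesis
    using that[of A B] unfolding disjnt_def by blast
qed

context Metric_space
begin

lemma perfect_in_small:
  assumes P: "perfect_in mtopology P" and e: "e > 0"
  obtains P' where "perfect_in mtopology P'" "P' \<subseteq> P" "\<forall>x\<in>P'. \<forall>y\<in>P'. d x y < e"
proof -
  obtain x where x: "x \<in> P" using P perfect_in_nonempty by blast
  then have xM: "x \<in> M" using perfect_in_subset_topspace[OF P] by auto
  obtain P' where P': "perfect_in mtopology P'" "P' \<subseteq> P \<inter> mball x (e/2)"
    using perfect_in_open_piece[OF regular_space_mtopology P, of "mball x (e/2)" x] x xM e by auto
  have "d y z < e" if "y \<in> P'" "z \<in> P'" for y z
  proof -
    have "d x y < e/2" "d x z < e/2" "y \<in> M" "z \<in> M" using that P' by auto
    then show ?thesis using triangle[of y x z] commute[of x y] xM by simp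
  qed
  then show thesis using that P' by blast
qed

lemma nested_closed_nonempty:
  fixes C :: "nat \<Rightarrow> 'a set"
  assumes "mcomplete" "\<And>n. closedin mtopology (C n)" "\<And>n. C n \<noteq> {}"
    and sub: "\<And>n. C (Suc n) \<subseteq> C n"
    and small: "\<And>e. e > 0 \<Longrightarrow> \<exists>n. \<forall>x\<in>C n. \<forall>y\<in>C n. d x y < e"
  obtains z where "\<And>n. z \<in> C n"
proof -
  have "\<exists>n a. C n \<subseteq> mcball a e" if e: "e > 0" for e
  proof -
    obtain n where n: "\<forall>x\<in>C n. \<forall>y\<in>C n. d x y < e" using small[OF e] by blast
    obtain a where a: "a \<in> C n" using assms(3) by blast
    have "C n \<subseteq> M" using assms(2) closedin_subset by fastforce
    then have "C n \<subseteq> mcball a e" using n a by (force simp: subset_iff)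
    then show ?thesis by blast
  qed
  moreover have "decseq C" using sub by (simp add: decseq_Suc_iff)
  ultimately have "\<Inter>(range C) \<noteq> {}"
    using assms(1-3) unfolding mcomplete_nest by blast
  then show thesis using that by blast
qed

end

text \<open>
  A Cantor scheme whose levels become metrically small. Nodes are bit lists with the most recent
  choice at the head, so that the parent of a node is its tail.
\<close>

locale cantor_scheme = Metric_space +
  fixes G :: "bool list \<Rightarrow> 'a set"
  assumes complete: "mcomplete"
    and closed: "\<And>s. closedin mtopology (G s)"
    and nonempty: "\<And>s. G s \<noteq> {}"
    and nested: "\<And>b s. G (b # s) \<subseteq> G s"
    and disjoint: "\<And>s. G (True # s) \<inter> G (False # s) = {}"
    and vanishing: "\<And>e. e > 0 \<Longrightarrow> \<exists>k. \<forall>s. length s = k \<longrightarrow> (\<forall>x\<in>G s. \<forall>y\<in>G s. d x y < e)"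
begin

text \<open>
  The union is taken level by level, not along branches: each level is a finite union of closed
  sets, which makes the kernel visibly closed. Disjointness gives back the branches.
\<close>

definition kernel :: "'a set" where
  "kernel = (\<Inter>k. \<Union>s\<in>{s. length s = k}. G s)"

lemma finite_level: "finite {s :: bool list. length s = k}"
  using finite_lists_length_eq[of "UNIV :: bool set" k] by simp

lemma kernel_in_level: "x \<in> kernel \<Longrightarrow> \<exists>s. length s = k \<and> x \<in> G s"
  unfolding kernel_def by blast

lemma kernel_subset_root: "kernel \<subseteq> G []"
  using kernel_in_level[of _ 0] by auto

lemma append_subset: "G (t @ s) \<subseteq> G s"
  by (induction t) (use nested in auto)

lemma level_disjoint:
  assumes "length s = length t" "s \<noteq> t"
  shows "G s \<inter> G t = {}"
  using assms
proof (induction s t rule: list_induct2)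
  case (Cons b s c t)
  show ?case
  proof (cases "s = t")
    case True
    then have "c = (\<not> b)" using Cons.prems by auto
    then show ?thesis using disjoint[of s] True by (cases b) auto
  next
    case False
    then show ?thesis using Cons.IH nested[of b s] nested[of c t] by auto
  qed
qed simp

text \<open>
  Any infinite branch through \<open>s\<close> shrinks to a point of the kernel by completeness; the branch
  that always chooses \<open>True\<close> serves.
\<close>

lemma kernel_meets: "G s \<inter> kernel \<noteq> {}"
proof -
  define C where "C n = G (replicate n True @ s)" for n
  have "\<exists>n. \<forall>x\<in>C n. \<forall>y\<in>C n. d x y < e" if e: "e > 0" for e
  proof -
    obtain k where k: "\<And>s. length s = k \<Longrightarrow> (\<forall>x\<in>G s. \<forall>y\<in>G s. d x y < e)"
      using vanishing[OF e] by blast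
    have "C k \<subseteq> G (drop (length s) (replicate k True @ s))"
      unfolding C_def by (metis append_subset append_take_drop_id)
    with k[of "drop (length s) (replicate k True @ s)"] show ?thesis by force
  qed
  moreover have "C (Suc n) \<subseteq> C n" for n using nested by (simp add: C_def)
  ultimately obtain z where z: "\<And>n. z \<in> C n"
    using nested_closed_nonempty[of C] complete closed nonempty unfolding C_def by blast
  have "z \<in> kernel"
    unfolding kernel_def
  proof (intro INT_I UN_I CollectI)
    fix k
    \<comment> \<open>Without its first \<open>length s\<close> bits, \<open>?t\<close> is the node of level \<open>k\<close> on the branch.\<close>
    let ?t = "replicate k True @ s"
    show "length (drop (length s) ?t) = k" by simp
    show "z \<in> G (drop (length s) ?t)"
      using z[of k] append_subset unfolding C_def by (metis append_take_drop_id subsetD)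
  qed
  then show ?thesis using z[of 0] unfolding C_def by auto
qed

text \<open>
  A ball around a kernel point contains a whole node, and both children of that node contain
  kernel points, so the ball contains at least two of them.
\<close>

lemma perfect_in_kernel: "perfect_in mtopology kernel"
  unfolding perfect_in_iff
proof (intro conjI ballI allI impI)
  show "closedin mtopology kernel"
    unfolding kernel_def
    by (intro closedin_Inter) (auto intro!: closedin_Union simp: finite_level closed)
  show "kernel \<noteq> {}" using kernel_meets by blast
  fix x U assume x: "x \<in> kernel" and U: "openin mtopology U \<and> x \<in> U"
  obtain e where e: "e > 0" "mball x e \<subseteq> U" using U unfolding openin_mtopology by blast
  obtain k where k: "\<And>s. length s = k \<Longrightarrow> (\<forall>x\<in>G s. \<forall>y\<in>G s. d x y < e)"
    using vanishing[OF e(1)] by blast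
  obtain s where s: "length s = k" "x \<in> G s" using kernel_in_level[OF x] by blast
  have "G s \<subseteq> M" using closed closedin_subset by fastforce
  then have GU: "G s \<subseteq> U" using k[OF s(1)] s e(2) by (force simp: subset_iff)
  obtain y z where "y \<in> G (True # s) \<inter> kernel" "z \<in> G (False # s) \<inter> kernel"
    using kernel_meets by blast
  then have "y \<in> kernel \<inter> U" "z \<in> kernel \<inter> U" "y \<noteq> z"
    using nested[of True s] nested[of False s] disjoint[of s] GU by auto
  then show "\<exists>y\<in>kernel \<inter> U. y \<noteq> x" by metis
qed

text \<open>
  The trace of a node on the kernel is relatively open: its complement is covered by the finitely
  many other nodes of the same level, which are closed.
\<close>

lemma kernel_piece_open:
  assumes x: "x \<in> kernel" "x \<in> G s"
  obtains U where "openin mtopology U" "x \<in> U" "kernel \<inter> U \<subseteq> G s"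
proof
  let ?K = "\<Union>t\<in>{t. length t = length s} - {s}. G t"
  have "closedin mtopology ?K"
    by (intro closedin_Union) (auto simp: finite_level closed)
  then show "openin mtopology (M - ?K)" by (metis openin_diff openin_topspace topspace_mtopology)
  have "G s \<subseteq> M" using closed closedin_subset by fastforce
  then show "x \<in> M - ?K" using x level_disjoint[of _ s] by blast
  show "kernel \<inter> (M - ?K) \<subseteq> G s" using kernel_in_level[of _ "length s"] by blast
qed

end

section \<open>Fusion of perfect cubes\<close>

text \<open>
  Each factor comes with a fixed complete metric. It only serves to measure how small a side of a
  cube is; all conclusions are topological.
\<close>

locale complete_factors =
  fixes d :: enat and X :: "nat \<Rightarrow> 'a topology" and \<delta> :: "nat \<Rightarrow> 'a \<Rightarrow> 'a \<Rightarrow> real"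
  assumes metric: "\<And>m. m \<in> index_set d \<Longrightarrow> Metric_space (topspace (X m)) (\<delta> m)"
    and mtopology: "\<And>m. m \<in> index_set d \<Longrightarrow>
          Metric_space.mtopology (topspace (X m)) (\<delta> m) = X m"
    and complete: "\<And>m. m \<in> index_set d \<Longrightarrow> Metric_space.mcomplete (topspace (X m)) (\<delta> m)"
begin

abbreviation I :: "nat set" where "I \<equiv> index_set d"

text \<open>
  Cubes are handled through their families of sides. Since \<open>F'\<close> is required to be perfect,
  \<open>F \<preceq> F\<close> says that \<open>F\<close> itself consists of perfect sets.
\<close>

definition refines :: "(nat \<Rightarrow> 'a set) \<Rightarrow> (nat \<Rightarrow> 'a set) \<Rightarrow> bool" (infix \<open>\<preceq>\<close> 50) where
  "F' \<preceq> F \<longleftrightarrow> (\<forall>m\<in>I. perfect_in (X m) (F' m) \<and> F' m \<subseteq> F m)"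

text \<open>
  Stage \<open>n\<close> of a fusion has only split the coordinates up to \<open>n\<close>, so only those are asked to be
  small; every fixed coordinate is constrained from some stage on.
\<close>

definition small :: "nat \<Rightarrow> (nat \<Rightarrow> 'a set) \<Rightarrow> bool" where
  "small n F \<longleftrightarrow> (\<forall>m\<in>I. m \<le> n \<longrightarrow> (\<forall>x\<in>F m. \<forall>y\<in>F m. \<delta> m x y < inverse (real (Suc n))))"

lemma refines_trans: "F'' \<preceq> F' \<Longrightarrow> F' \<preceq> F \<Longrightarrow> F'' \<preceq> F"
  unfolding refines_def by blast

lemma refines_refl: "F' \<preceq> F \<Longrightarrow> F' \<preceq> F'"
  unfolding refines_def by blast

lemma perfect_cube_iff: "perfect_cube d X P \<longleftrightarrow> (\<exists>F. F \<preceq> F \<and> P = Pi\<^sub>E I F)"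
  unfolding perfect_cube_def refines_def by blast

lemma refines_imp_subset: "F' \<preceq> F \<Longrightarrow> Pi\<^sub>E I F' \<subseteq> Pi\<^sub>E I F"
  unfolding refines_def by (simp add: PiE_mono)

lemma refines_iff_subset:
  assumes "F' \<preceq> F'" shows "F' \<preceq> F \<longleftrightarrow> Pi\<^sub>E I F' \<subseteq> Pi\<^sub>E I F"
proof -
  have "F' m \<noteq> {}" if "m \<in> I" for m
    using assms that perfect_in_nonempty unfolding refines_def by blast
  then have "Pi\<^sub>E I F' \<noteq> {}" by (simp add: PiE_eq_empty_iff)
  then show ?thesis
    using assms unfolding refines_def subset_PiE by auto
qed

lemma perfect_cube_nonempty: "perfect_cube d X P \<Longrightarrow> P \<noteq> {}"
  unfolding perfect_cube_def using perfect_in_nonempty PiE_eq_empty_iff by metis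

lemma perfect_cube_subset_topspace:
  "perfect_cube d X P \<Longrightarrow> P \<subseteq> topspace (cube_topology d X)"
  unfolding perfect_cube_def cube_topology_def topspace_product_topology
  using perfect_in_subset_topspace by (auto intro!: PiE_mono)

lemma perfect_side_split:
  assumes "m \<in> I" "perfect_in (X m) A"
  shows "\<exists>H. (\<forall>b. perfect_in (X m) (H b) \<and> H b \<subseteq> A) \<and> H True \<inter> H False = {}"
proof -
  interpret Metric_space "topspace (X m)" "\<delta> m" using metric assms(1) .
  obtain B C where "perfect_in (X m) B" "perfect_in (X m) C" "B \<subseteq> A" "C \<subseteq> A" "B \<inter> C = {}"
    using perfect_in_split[of "X m" A] assms regular_space_mtopology Hausdorff_space_mtopology
      mtopology by metis
  then show ?thesis by (intro exI[of _ "\<lambda>b. if b then B else C"]) auto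
qed

lemma small_refinement:
  assumes "F \<preceq> F"
  shows "\<exists>F'. F' \<preceq> F \<and> small n F'"
proof -
  have "\<exists>P'. perfect_in (X m) P' \<and> P' \<subseteq> F m \<and>
      (\<forall>x\<in>P'. \<forall>y\<in>P'. \<delta> m x y < inverse (real (Suc n)))" if m: "m \<in> I" for m
  proof -
    interpret Metric_space "topspace (X m)" "\<delta> m" using metric m .
    show ?thesis
      using perfect_in_small[of "F m" "inverse (real (Suc n))"] assms mtopology[OF m] m
      unfolding refines_def by (metis inverse_positive_iff_positive of_nat_0_less_iff zero_less_Suc)
  qed
  then show ?thesis unfolding refines_def small_def by metis
qed

lemma small_mono: "F' \<preceq> F \<Longrightarrow> small n F \<Longrightarrow> small n F'"
  unfolding refines_def small_def by blast

text \<open>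
  \<open>T m s\<close> is the part with name \<open>s\<close> of coordinate \<open>m\<close>; a tuple \<open>\<sigma>\<close> of names selects a cube. Two
  tuples may share parts, so their cubes cannot be shrunk independently. Treating the tuples
  one after another and shrinking the shared parts works because \<open>E\<close>, once attained by a
  cube, persists when its sides shrink further.
\<close>

lemma refine_finitely_many:
  fixes T :: "nat \<Rightarrow> bool list \<Rightarrow> 'a set" and E :: "(nat \<Rightarrow> 'a set) \<Rightarrow> bool"
  assumes fin: "finite S" and T: "\<And>s. (\<lambda>m. T m s) \<preceq> F0"
    and dense: "\<And>F. F \<preceq> F0 \<Longrightarrow> \<exists>F'. F' \<preceq> F \<and> E F'"
    and mono: "\<And>F F'. F' \<preceq> F \<Longrightarrow> E F \<Longrightarrow> E F'"
  shows "\<exists>T'. (\<forall>s. (\<lambda>m. T' m s) \<preceq> (\<lambda>m. T m s)) \<and> (\<forall>\<sigma>\<in>S. E (\<lambda>m. T' m (\<sigma> m)))"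
  using fin
proof (induction S)
  case empty
  then show ?case using T refines_refl by (auto intro!: exI[of _ T])
next
  case (insert \<sigma> S)
  then obtain T' where T': "\<And>s. (\<lambda>m. T' m s) \<preceq> (\<lambda>m. T m s)" "\<And>\<tau>. \<tau> \<in> S \<Longrightarrow> E (\<lambda>m. T' m (\<tau> m))"
    by blast
  have "(\<lambda>m. T' m (\<sigma> m)) \<preceq> F0"
    using T' T unfolding refines_def by blast
  then obtain F where F: "F \<preceq> (\<lambda>m. T' m (\<sigma> m))" "E F" using dense by blast
  define T'' where "T'' m s = (if s = \<sigma> m then F m else T' m s)" for m s
  have below: "(\<lambda>m. T'' m (\<tau> m)) \<preceq> (\<lambda>m. T' m (\<tau> m))" for \<tau> :: "nat \<Rightarrow> bool list"
    using F(1) T'(1) unfolding refines_def T''_def by auto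
  have "(\<lambda>m. T'' m s) \<preceq> (\<lambda>m. T m s)" for s
    using below[of "\<lambda>_. s"] T'(1) refines_trans by blast
  moreover have "E (\<lambda>m. T'' m (\<tau> m))" if "\<tau> \<in> insert \<sigma> S" for \<tau>
    using F(2) T'(2) below mono that by (auto simp: T''_def cong: if_cong)
  ultimately show ?case by blast
qed

text \<open>
  At stage \<open>n\<close> coordinate \<open>m\<close> has been split \<open>n - m\<close> times. The subtraction is truncated: a
  coordinate \<open>m \<ge> n\<close> is still in one piece, which keeps the number of tuples finite even when
  there are infinitely many coordinates.
\<close>

definition level_tuples :: "nat \<Rightarrow> (nat \<Rightarrow> bool list) set" where
  "level_tuples n = {\<sigma>. \<forall>m. length (\<sigma> m) = n - m}"

lemma finite_level_tuples: "finite (level_tuples n)"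
proof (rule finite_subset)
  let ?L = "{s :: bool list. set s \<subseteq> UNIV \<and> length s \<le> n}"
  show "level_tuples n \<subseteq> {\<sigma>. \<forall>m. (m \<in> {..<n} \<longrightarrow> \<sigma> m \<in> ?L) \<and> (m \<notin> {..<n} \<longrightarrow> \<sigma> m = [])}"
    by (auto simp: level_tuples_def) (metis diff_is_0_eq length_0_conv not_less)
  show "finite {\<sigma>. \<forall>m. (m \<in> {..<n} \<longrightarrow> \<sigma> m \<in> ?L) \<and> (m \<notin> {..<n} \<longrightarrow> \<sigma> m = [])}"
    by (intro finite_set_of_finite_funs finite_lists_length_le) auto
qed

text \<open>
  Coordinates that are already in play are split at all names \<open>s\<close> at once, whatever their length, so
  that parts need no side conditions on their names; only the tuples of the new level carry \<open>E\<close>.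
\<close>

definition fusion_step ::
  "((nat \<Rightarrow> 'a set) \<Rightarrow> bool) \<Rightarrow> nat \<Rightarrow> (nat \<Rightarrow> bool list \<Rightarrow> 'a set) \<Rightarrow> (nat \<Rightarrow> bool list \<Rightarrow> 'a set) \<Rightarrow> bool"
where
  "fusion_step E n T T' \<longleftrightarrow>
     (\<forall>m\<in>I. \<forall>s. if m \<le> n
        then (\<forall>b. T' m (b # s) \<subseteq> T m s) \<and> T' m (True # s) \<inter> T' m (False # s) = {}
        else T' m s \<subseteq> T m s) \<and>
     (\<forall>\<sigma>\<in>level_tuples (Suc n). E (\<lambda>m. T' m (\<sigma> m)))"

lemma fusion_step_exists:
  assumes T: "\<And>s. (\<lambda>m. T m s) \<preceq> F0"
    and dense: "\<And>F. F \<preceq> F0 \<Longrightarrow> \<exists>F'. F' \<preceq> F \<and> E F'"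
    and mono: "\<And>F F'. F' \<preceq> F \<Longrightarrow> E F \<Longrightarrow> E F'"
  shows "\<exists>T'. (\<forall>s. (\<lambda>m. T' m s) \<preceq> F0) \<and> fusion_step E n T T'"
proof -
  have "\<forall>m s. \<exists>H. m \<in> I \<longrightarrow> (\<forall>b. perfect_in (X m) (H b) \<and> H b \<subseteq> T m s) \<and> H True \<inter> H False = {}"
    using perfect_side_split T unfolding refines_def by (metis (no_types, lifting))
  then obtain H where H: "\<And>m s b. m \<in> I \<Longrightarrow> perfect_in (X m) (H m s b) \<and> H m s b \<subseteq> T m s"
      "\<And>m s. m \<in> I \<Longrightarrow> H m s True \<inter> H m s False = {}"
    by metis
  \<comment> \<open>Names of the wrong length never matter, so the root of a split coordinate gets a dummy value.\<close>
  define T1 where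
    "T1 m s = (if m \<le> n then (case s of [] \<Rightarrow> T m [] | b # s' \<Rightarrow> H m s' b) else T m s)" for m s
  have T_F0: "perfect_in (X m) (T m s) \<and> T m s \<subseteq> F0 m" if "m \<in> I" for m s
    using T that unfolding refines_def by blast
  have T1: "(\<lambda>m. T1 m s) \<preceq> F0" for s
    unfolding refines_def
  proof
    fix m assume m: "m \<in> I"
    show "perfect_in (X m) (T1 m s) \<and> T1 m s \<subseteq> F0 m"
    proof (cases s)
      case Nil
      then show ?thesis using T_F0[OF m] by (simp add: T1_def)
    next
      case (Cons b s')
      then show ?thesis using T_F0[OF m, of s] T_F0[OF m, of s'] H(1)[OF m, of s' b] by (auto simp: T1_def)
    qed
  qed
  have "\<exists>T'. (\<forall>s. (\<lambda>m. T' m s) \<preceq> (\<lambda>m. T1 m s)) \<and> (\<forall>\<sigma>\<in>level_tuples (Suc n). E (\<lambda>m. T' m (\<sigma> m)))"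
    using finite_level_tuples T1 dense mono by (rule refine_finitely_many)
  then obtain T' where T': "\<And>s. (\<lambda>m. T' m s) \<preceq> (\<lambda>m. T1 m s)"
      "\<And>\<sigma>. \<sigma> \<in> level_tuples (Suc n) \<Longrightarrow> E (\<lambda>m. T' m (\<sigma> m))"
    by blast
  have sub: "T' m s \<subseteq> T1 m s" if "m \<in> I" for m s
    using T'(1) that unfolding refines_def by blast
  have "T' m (b # s) \<subseteq> T m s" if "m \<in> I" "m \<le> n" for m b s
    using sub[of m "b # s"] H(1)[of m s b] that unfolding T1_def by auto
  moreover have "T' m (True # s) \<inter> T' m (False # s) = {}" if "m \<in> I" "m \<le> n" for m s
    using sub[of m "True # s"] sub[of m "False # s"] H(2)[of m s] that unfolding T1_def by auto
  moreover have "T' m s \<subseteq> T m s" if "m \<in> I" "\<not> m \<le> n" for m s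
    using sub[of m s] that unfolding T1_def by auto
  ultimately have "fusion_step E n T T'"
    using T'(2) unfolding fusion_step_def by auto
  moreover have "(\<lambda>m. T' m s) \<preceq> F0" for s
    using T'(1) T1 refines_trans by blast
  ultimately show ?thesis by blast
qed

text \<open>
  The engine of the whole proof. Given countably many hereditary properties of sets, each
  attainable on a subcube of any subcube of \<open>P\<close>, one perfect cube inside \<open>P\<close> has all of them
  locally. The parts of a single coordinate that appear in the successive stages form a Cantor
  scheme, whose kernel is a side of \<open>Q\<close>. The property \<open>D n\<close> is secured at stage \<open>n\<close> for the
  finitely many cubes of that stage, and these cut \<open>Q\<close> into relatively open pieces.
\<close>

theorem fusion:
  fixes D :: "nat \<Rightarrow> (nat \<Rightarrow> 'a) set \<Rightarrow> bool"
  assumes P: "perfect_cube d X P"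
    and dense: "\<And>n R. perfect_cube d X R \<Longrightarrow> R \<subseteq> P \<Longrightarrow>
                  \<exists>R'. perfect_cube d X R' \<and> R' \<subseteq> R \<and> D n R'"
    and hereditary: "\<And>n Z Z'. Z' \<subseteq> Z \<Longrightarrow> D n Z \<Longrightarrow> D n Z'"
  obtains Q where "perfect_cube d X Q" "Q \<subseteq> P"
    "\<And>n x. x \<in> Q \<Longrightarrow> \<exists>U. openin (cube_topology d X) U \<and> x \<in> U \<and> D n (Q \<inter> U)"
proof -
  obtain F0 where F0: "F0 \<preceq> F0" "P = Pi\<^sub>E I F0"
    using P unfolding perfect_cube_iff by blast
  \<comment> \<open>Smallness is added to the property so that the parts of each coordinate shrink to points.\<close>
  define E where "E n F \<longleftrightarrow> D n (Pi\<^sub>E I F) \<and> small n F" for n F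
  have E_mono: "E n F'" if "F' \<preceq> F" "E n F" for n F F'
    using hereditary[OF refines_imp_subset[OF that(1)]] small_mono[OF that(1)] that(2)
    unfolding E_def by blast
  have E_dense: "\<exists>F'. F' \<preceq> F \<and> E n F'" if F: "F \<preceq> F0" for n F
  proof -
    obtain F1 where F1: "F1 \<preceq> F" "small n F1"
      using small_refinement[OF refines_refl[OF F]] by blast
    have "perfect_cube d X (Pi\<^sub>E I F1)"
      unfolding perfect_cube_iff using refines_refl[OF F1(1)] by blast
    moreover have "Pi\<^sub>E I F1 \<subseteq> P"
      using refines_imp_subset[OF refines_trans[OF F1(1) F]] F0(2) by simp
    ultimately have "\<exists>R'. perfect_cube d X R' \<and> R' \<subseteq> Pi\<^sub>E I F1 \<and> D n R'" by (rule dense)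
    then obtain F2 where F2: "F2 \<preceq> F2" "Pi\<^sub>E I F2 \<subseteq> Pi\<^sub>E I F1" "D n (Pi\<^sub>E I F2)"
      unfolding perfect_cube_iff by blast
    then have "F2 \<preceq> F1" using refines_iff_subset[OF F2(1)] by simp
    then show ?thesis
      using refines_trans[OF _ F1(1)] small_mono[OF _ F1(2)] F2(3) unfolding E_def by blast
  qed
  obtain T where T: "\<And>n s. (\<lambda>m. T n m s) \<preceq> F0" and
      step: "\<And>n. fusion_step (E n) n (T n) (T (Suc n))"
  proof -
    have "\<exists>T. \<forall>n. (\<forall>s. (\<lambda>m. T n m s) \<preceq> F0) \<and> fusion_step (E n) n (T n) (T (Suc n))"
    proof (rule dependent_nat_choice)
      show "\<exists>T. \<forall>s. (\<lambda>m. T m s) \<preceq> F0"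
        using F0 by (intro exI[of _ "\<lambda>m s. F0 m"]) simp
      show "\<exists>T'. (\<forall>s. (\<lambda>m. T' m s) \<preceq> F0) \<and> fusion_step (E n) n T T'"
        if "\<forall>s. (\<lambda>m. T m s) \<preceq> F0" for T n
        using fusion_step_exists[of T F0 "E n" n] that E_dense E_mono by blast
    qed
    then show thesis using that by blast
  qed
  have T_perfect: "perfect_in (X m) (T n m s)" and T_F0: "T n m s \<subseteq> F0 m" if "m \<in> I" for n m s
    using T that unfolding refines_def by blast+
  have split_sub: "T (Suc n) m (b # s) \<subseteq> T n m s" if "m \<in> I" "m \<le> n" for n m b s
    using step[of n] that unfolding fusion_step_def by auto
  have split_disj: "T (Suc n) m (True # s) \<inter> T (Suc n) m (False # s) = {}"
    if "m \<in> I" "m \<le> n" for n m s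
    using step[of n] that unfolding fusion_step_def by auto
  have wait: "T (Suc n) m s \<subseteq> T n m s" if "m \<in> I" "n < m" for n m s
    using step[of n] that unfolding fusion_step_def by auto
  have wait': "T m m s \<subseteq> T n m s" if "m \<in> I" "n \<le> m" for n m s
    using that(2)
  proof (induction n rule: inc_induct)
    case (step n)
    then show ?case using wait[OF that(1), of n s] by blast
  qed simp
  have E_tuple: "E n (\<lambda>m. T (Suc n) m (\<sigma> m))" if "\<sigma> \<in> level_tuples (Suc n)" for n \<sigma>
    using step[of n] that unfolding fusion_step_def by auto
  \<comment> \<open>Level \<open>k\<close> of coordinate \<open>m\<close> comes into being at stage \<open>m + k\<close>.\<close>
  define G where "G m s = T (m + length s) m s" for m s
  have scheme: "cantor_scheme (topspace (X m)) (\<delta> m) (G m)" if m: "m \<in> I" for m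
  proof -
    interpret Metric_space "topspace (X m)" "\<delta> m" using metric m .
    show ?thesis
    proof
      show "mcomplete" using complete m .
      show "closedin mtopology (G m s)" "G m s \<noteq> {}" for s
        using T_perfect[OF m] mtopology[OF m] unfolding G_def perfect_in_def by auto
      show "G m (b # s) \<subseteq> G m s" for b s
        using split_sub[OF m, of "m + length s"] unfolding G_def by simp
      show "G m (True # s) \<inter> G m (False # s) = {}" for s
        using split_disj[OF m, of "m + length s"] unfolding G_def by simp
      fix e :: real assume "e > 0"
      then obtain k where k: "inverse (real (Suc k)) < e" using reals_Archimedean by blast
      have "\<delta> m x y < e" if s: "length s = Suc k" and xy: "x \<in> G m s" "y \<in> G m s" for s x y
      proof -
        let ?n = "m + k"
        \<comment> \<open>Any tuple of stage \<open>m + k + 1\<close> that uses \<open>s\<close> in coordinate \<open>m\<close> bounds its diameter.\<close>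
        let ?\<sigma> = "\<lambda>i. if i = m then s else replicate (Suc ?n - i) True"
        have "?\<sigma> \<in> level_tuples (Suc ?n)" using s by (auto simp: level_tuples_def)
        then have "small ?n (\<lambda>i. T (Suc ?n) i (?\<sigma> i))" using E_tuple E_def by blast
        then have "\<delta> m x y < inverse (real (Suc ?n))"
          using m xy s unfolding small_def G_def by auto
        also have "\<dots> \<le> inverse (real (Suc k))" by (intro le_imp_inverse_le) auto
        finally show ?thesis using k by simp
      qed
      then show "\<exists>k. \<forall>s. length s = k \<longrightarrow> (\<forall>x\<in>G m s. \<forall>y\<in>G m s. \<delta> m x y < e)" by blast
    qed
  qed
  define K where "K m = cantor_scheme.kernel (G m)" for m
  have K_perfect: "perfect_in (X m) (K m)" and K_F0: "K m \<subseteq> F0 m" and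
    K_level: "\<And>x k. x \<in> K m \<Longrightarrow> \<exists>s. length s = k \<and> x \<in> G m s" and
    K_open: "\<And>x s. x \<in> K m \<Longrightarrow> x \<in> G m s \<Longrightarrow>
        \<exists>U. openin (X m) U \<and> x \<in> U \<and> K m \<inter> U \<subseteq> G m s" if m: "m \<in> I" for m
  proof -
    interpret cantor_scheme "topspace (X m)" "\<delta> m" "G m" using scheme m .
    show "perfect_in (X m) (K m)" using perfect_in_kernel mtopology[OF m] K_def by simp
    show "K m \<subseteq> F0 m" using kernel_subset_root T_F0[OF m] unfolding K_def G_def by blast
    show "\<exists>s. length s = k \<and> x \<in> G m s" if "x \<in> K m" for x k
      using that kernel_in_level unfolding K_def by blast
    show "\<exists>U. openin (X m) U \<and> x \<in> U \<and> K m \<inter> U \<subseteq> G m s" if "x \<in> K m" "x \<in> G m s" for x s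
      using that kernel_piece_open mtopology[OF m] unfolding K_def by metis
  qed
  have KF0: "K \<preceq> F0" using K_perfect K_F0 unfolding refines_def by blast
  show thesis
  proof (rule that[of "Pi\<^sub>E I K"])
    show "perfect_cube d X (Pi\<^sub>E I K)" unfolding perfect_cube_iff using KF0 refines_refl by blast
    show "Pi\<^sub>E I K \<subseteq> P" using KF0 F0 refines_imp_subset by blast
    fix n x assume x: "x \<in> Pi\<^sub>E I K"
    have "\<exists>s U. length s = Suc n - m \<and> (m \<in> I \<longrightarrow> openin (X m) U \<and> x m \<in> U \<and> K m \<inter> U \<subseteq> G m s)" for m
    proof (cases "m \<in> I")
      case True
      then show ?thesis using K_level[OF True, of "x m" "Suc n - m"] K_open[OF True, of "x m"] x
        by (metis PiE_mem)
    next
      case False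
      then show ?thesis by (intro exI[of _ "replicate (Suc n - m) True"]) simp
    qed
    then obtain \<sigma> V where \<sigma>: "\<And>m. length (\<sigma> m) = Suc n - m" and
      V: "\<And>m. m \<in> I \<Longrightarrow> openin (X m) (V m) \<and> x m \<in> V m \<and> K m \<inter> V m \<subseteq> G m (\<sigma> m)"
      by metis
    \<comment> \<open>Coordinates beyond \<open>n\<close> are unsplit at this stage and put no condition on \<open>U\<close>.\<close>
    define U where "U = Pi\<^sub>E I (\<lambda>m. if m \<le> n then V m else topspace (X m))"
    have "finite {m\<in>I. (if m \<le> n then V m else topspace (X m)) \<noteq> topspace (X m)}"
      by (rule finite_subset[of _ "{..n}"]) auto
    then have "openin (cube_topology d X) U"
      unfolding cube_topology_def U_def openin_PiE_gen using V by auto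
    moreover have "x m \<in> topspace (X m)" if "m \<in> I" for m
      using PiE_mem[OF x that] perfect_in_subset_topspace[OF K_perfect[OF that]] by blast
    then have "x \<in> U" using x V unfolding U_def by (simp add: PiE_iff)
    moreover have "D n (Pi\<^sub>E I K \<inter> U)"
    proof (rule hereditary)
      show "D n (Pi\<^sub>E I (\<lambda>m. T (Suc n) m (\<sigma> m)))"
        using E_tuple[of \<sigma> n] \<sigma> unfolding E_def level_tuples_def by blast
      have "K m \<inter> (if m \<le> n then V m else topspace (X m)) \<subseteq> T (Suc n) m (\<sigma> m)" if m: "m \<in> I" for m
      proof (cases "m \<le> n")
        case True
        then show ?thesis using V[OF m] \<sigma>[of m] unfolding G_def by auto
      next
        case False
        then have "\<sigma> m = []" using \<sigma>[of m] by simp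
        moreover have "K m \<subseteq> T m m []" using K_level[OF m, of _ 0] unfolding G_def by auto
        ultimately show ?thesis using wait'[OF m, of "Suc n" "[]"] False by auto
      qed
      then show "Pi\<^sub>E I K \<inter> U \<subseteq> Pi\<^sub>E I (\<lambda>m. T (Suc n) m (\<sigma> m))"
        unfolding U_def PiE_Int by (rule PiE_mono)
    qed
    ultimately show "\<exists>U. openin (cube_topology d X) U \<and> x \<in> U \<and> D n (Pi\<^sub>E I K \<inter> U)" by blast
  qed
qed

end

section \<open>Bernstein sets\<close>

unbundle cardinal_syntax

text \<open>
  Enumerate the index type in a well-order of minimal length and choose, for each \<open>i\<close>, two
  points of \<open>K i\<close> that differ from each other and from all points chosen earlier. Fewer points
  were chosen earlier than \<open>K i\<close> has, so this never gets stuck. The first points form \<open>A\<close>; the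
  second points avoid it.
\<close>

lemma bernstein_set:
  fixes K :: "'i \<Rightarrow> 'c set"
  assumes inf: "infinite (UNIV :: 'i set)" and large: "\<And>i. |UNIV :: 'i set| \<le>o |K i|"
  obtains A where "\<And>i. K i \<inter> A \<noteq> {}" "\<And>i. \<not> K i \<subseteq> A"
proof -
  let ?r = "|UNIV :: 'i set|"
  have wf: "wf (?r - Id)"
    using card_of_Well_order well_order_on_def by blast
  define old where "old \<phi> i = (\<Union>j\<in>underS ?r i. {fst (\<phi> j), snd (\<phi> j)})"
    for \<phi> :: "'i \<Rightarrow> 'c \<times> 'c" and i
  have "\<exists>\<phi>. \<forall>i. {fst (\<phi> i), snd (\<phi> i)} \<subseteq> K i - old \<phi> i \<and> fst (\<phi> i) \<noteq> snd (\<phi> i)"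
  proof (rule dependent_wf_choice[OF wf])
    fix \<phi> \<psi> :: "'i \<Rightarrow> 'c \<times> 'c" and i p
    assume "\<And>j. (j, i) \<in> ?r - Id \<Longrightarrow> \<phi> j = \<psi> j"
    then have "old \<phi> i = old \<psi> i" by (auto simp: old_def underS_def)
    then show "({fst p, snd p} \<subseteq> K i - old \<phi> i \<and> fst p \<noteq> snd p) =
        ({fst p, snd p} \<subseteq> K i - old \<psi> i \<and> fst p \<noteq> snd p)" by simp
  next
    fix i and \<phi> :: "'i \<Rightarrow> 'c \<times> 'c"
    have under: "|underS ?r i| <o ?r"
      by (rule card_of_underS[OF card_of_Card_order]) (simp add: Field_card_of)
    have small: "|g ` underS ?r i| <o ?r" for g :: "'i \<Rightarrow> 'c"
      using card_of_image under by (rule ordLeq_ordLess_trans)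
    have single: "|{c}| <o ?r" for c :: 'c
      using inf card_of_Well_order[of "{c}"] card_of_Well_order[of "UNIV :: 'i set"]
      by (intro finite_ordLess_infinite) (auto simp: Field_card_of)
    have "old \<phi> i = (\<lambda>j. fst (\<phi> j)) ` underS ?r i \<union> (\<lambda>j. snd (\<phi> j)) ` underS ?r i"
      by (auto simp: old_def)
    then have old: "|old \<phi> i| <o ?r"
      using card_of_Un_ordLess_infinite[OF inf small small] by simp
    have escape: "\<exists>a\<in>K i. a \<notin> Z" if "|Z| <o ?r" for Z
    proof (rule ccontr)
      assume "\<not> ?thesis"
      then have "K i \<subseteq> Z" by blast
      then have "|K i| \<le>o |Z|" by (rule card_of_mono1)
      then have "?r \<le>o |Z|" using large ordLeq_transitive by blast
      then show False using that not_ordLess_ordLeq by blast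
    qed
    obtain a where a: "a \<in> K i" "a \<notin> old \<phi> i" using escape[OF old] by blast
    obtain b where "b \<in> K i" "b \<notin> old \<phi> i \<union> {a}"
      using escape[OF card_of_Un_ordLess_infinite[OF inf old single]] by blast
    then show "\<exists>p. {fst p, snd p} \<subseteq> K i - old \<phi> i \<and> fst p \<noteq> snd p"
      using a by (intro exI[of _ "(a, b)"]) auto
  qed
  then obtain \<phi> where \<phi>: "\<And>i. {fst (\<phi> i), snd (\<phi> i)} \<subseteq> K i - old \<phi> i"
    "\<And>i. fst (\<phi> i) \<noteq> snd (\<phi> i)" by blast
  have "snd (\<phi> i) \<noteq> fst (\<phi> j)" for i j
  proof -
    have "i = j \<or> i \<in> underS ?r j \<or> j \<in> underS ?r i"
      using card_of_Well_order[of "UNIV :: 'i set"]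
      unfolding well_order_on_def linear_order_on_def total_on_def underS_def Field_card_of by auto
    then show ?thesis using \<phi>(1)[of i] \<phi>(1)[of j] \<phi>(2)[of i] unfolding old_def by fastforce
  qed
  then have "snd (\<phi> i) \<notin> range (\<lambda>j. fst (\<phi> j))" for i by blast
  then show thesis using that[of "range (\<lambda>j. fst (\<phi> j))"] \<phi>(1) by blast
qed

section \<open>Functions all of whose fibre unions are decided\<close>

lemma separable_metrizable_countable_base:
  assumes "metrizable_space X" "separable_space X"
  obtains B :: "nat \<Rightarrow> 'a set" where "\<And>n. openin X (B n)"
    "\<And>U x. openin X U \<Longrightarrow> x \<in> U \<Longrightarrow> \<exists>n. x \<in> B n \<and> B n \<subseteq> U"
proof -
  obtain M \<rho> where M: "Metric_space M \<rho>" "X = Metric_space.mtopology M \<rho>"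
    using assms(1) unfolding metrizable_space_def by blast
  interpret Metric_space M \<rho> using M(1) .
  obtain C where C: "countable C" "C \<subseteq> M" "mtopology closure_of C = M"
    using assms(2) unfolding separable_space_def M(2) by auto
  \<comment> \<open>The empty set only ensures that the base is non-empty and hence the range of a sequence.\<close>
  define \<B> where "\<B> = insert {} ((\<lambda>(c, k). mball c (inverse (real (Suc k)))) ` (C \<times> UNIV))"
  have "countable \<B>" using C(1) unfolding \<B>_def by simp
  then have range: "range (from_nat_into \<B>) = \<B>"
    by (simp add: \<B>_def range_from_nat_into)
  show thesis
  proof (rule that[of "from_nat_into \<B>"])
    show "openin X (from_nat_into \<B> n)" for n
    proof -
      have "from_nat_into \<B> n \<in> \<B>" using range by blast
      then show ?thesis unfolding M(2) \<B>_def by auto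
    qed
    fix U x assume U: "openin X U" "x \<in> U"
    then obtain e where e: "e > 0" "mball x e \<subseteq> U" and x: "x \<in> M"
      unfolding M(2) openin_mtopology by blast
    obtain k where k: "inverse (real (Suc k)) < e / 2"
      using reals_Archimedean[of "e / 2"] e(1) by auto
    let ?\<epsilon> = "inverse (real (Suc k))"
    have "x \<in> mtopology closure_of C" using C(3) x by simp
    moreover have "?\<epsilon> > 0" by simp
    ultimately obtain c where "c \<in> C" "c \<in> mball x ?\<epsilon>"
      unfolding metric_closure_of by blast
    then have c: "c \<in> C" "\<rho> x c < ?\<epsilon>" by (auto simp del: of_nat_Suc)
    have "mball c ?\<epsilon> \<in> \<B>" using c(1) unfolding \<B>_def by force
    then obtain n where n: "from_nat_into \<B> n = mball c ?\<epsilon>" using range by (metis imageE)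
    have cM: "c \<in> M" using c(1) C(2) by blast
    have "mball c ?\<epsilon> \<subseteq> mball x e"
    proof
      fix z assume "z \<in> mball c ?\<epsilon>"
      then have "z \<in> M" "\<rho> c z < ?\<epsilon>" by auto
      then show "z \<in> mball x e" using triangle[of x c z] x cM c(2) k by simp
    qed
    then show "\<exists>n. x \<in> from_nat_into \<B> n \<and> from_nat_into \<B> n \<subseteq> U"
      using n e(2) c(2) x cM commute[of c x] by (intro exI[of _ n]) auto
  qed
qed

context complete_factors
begin

text \<open>
  The part of the \<open>s\<close>-property of a set that concerns subcubes of \<open>P\<close>. Unlike membership in
  \<open>s_sets\<close> it depends only on the trace of the set on \<open>P\<close>.
\<close>

definition decides :: "(nat \<Rightarrow> 'a) set \<Rightarrow> (nat \<Rightarrow> 'a) set \<Rightarrow> bool" where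
  "decides P A \<longleftrightarrow> (\<forall>R. perfect_cube d X R \<and> R \<subseteq> P \<longrightarrow>
     (\<exists>R'. perfect_cube d X R' \<and> R' \<subseteq> R \<and> (R' \<subseteq> A \<or> R' \<inter> A = {})))"

lemma decides_mono: "decides P A \<Longrightarrow> P' \<subseteq> P \<Longrightarrow> decides P' A"
  unfolding decides_def by blast

text \<open>
  If no \<open>A n\<close> contained a cube, then avoiding \<open>A n\<close> would be attainable on a subcube of every
  subcube of \<open>P\<close>. Fusion would give a non-empty cube that avoids every \<open>A n\<close>.
\<close>

lemma countable_cover_contains_cube:
  fixes A :: "nat \<Rightarrow> (nat \<Rightarrow> 'a) set"
  assumes P: "perfect_cube d X P" and dec: "\<And>n. decides P (A n)" and cover: "P \<subseteq> (\<Union>n. A n)"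
  obtains n R where "perfect_cube d X R" "R \<subseteq> P" "R \<subseteq> A n"
proof (rule ccontr)
  assume no: "\<not> thesis"
  note contained = that
  have dense: "\<exists>R'. perfect_cube d X R' \<and> R' \<subseteq> R \<and> R' \<inter> A n = {}"
    if R: "perfect_cube d X R" "R \<subseteq> P" for n R
  proof -
    obtain R' where R': "perfect_cube d X R'" "R' \<subseteq> R" "R' \<subseteq> A n \<or> R' \<inter> A n = {}"
      using dec[of n] R unfolding decides_def by blast
    then show ?thesis using contained[of R' n] no R(2) by blast
  qed
  obtain Q where Q: "perfect_cube d X Q" "Q \<subseteq> P" and
    open_disj: "\<And>n x. x \<in> Q \<Longrightarrow> \<exists>U. openin (cube_topology d X) U \<and> x \<in> U \<and> (Q \<inter> U) \<inter> A n = {}"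
    by (rule fusion[OF P, of "\<lambda>n Z. Z \<inter> A n = {}"]) (use dense in blast)+
  obtain x where x: "x \<in> Q" using perfect_cube_nonempty[OF Q(1)] by blast
  then obtain n where "x \<in> A n" using cover Q(2) by blast
  then show False using open_disj[OF x, of n] x by blast
qed

text \<open>
  Otherwise any two subcubes share a value of \<open>g\<close>, so for each \<open>n\<close> at most one of the two sets
  of values whose code does or does not contain \<open>n\<close> can include the image of a subcube, and by
  decidedness one of them does so below every subcube. Fusion over \<open>n\<close> gives a cube on which
  every bit of the code is fixed, and there \<open>g\<close> is constant. In other words, the sets of values
  that include the image of a subcube would form a countably complete ultrafilter on a set of at
  most continuum many values, and such an ultrafilter is principal.
\<close>

lemma cube_split_values:
  fixes g :: "(nat \<Rightarrow> 'a) \<Rightarrow> 'b" and code :: "'b \<Rightarrow> nat set"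
  assumes P: "perfect_cube d X P" and inj: "inj_on code (g ` P)"
    and dec: "\<And>A. decides P (g -` A)"
    and nonconstant: "\<And>R c. perfect_cube d X R \<Longrightarrow> R \<subseteq> P \<Longrightarrow> \<not> g ` R \<subseteq> {c}"
  obtains A B where "perfect_cube d X A" "perfect_cube d X B" "A \<subseteq> P" "B \<subseteq> P" "g ` A \<inter> g ` B = {}"
proof (rule ccontr)
  assume no: "\<not> thesis"
  have "\<exists>b. \<forall>R. perfect_cube d X R \<and> R \<subseteq> P \<longrightarrow>
      (\<exists>R'. perfect_cube d X R' \<and> R' \<subseteq> R \<and> (\<forall>x\<in>R'. (n \<in> code (g x)) = b))" for n
  proof (rule ccontr)
    let ?A = "{y. n \<in> code y}"
    assume neg: "\<not> ?thesis"
    have "\<exists>R'. perfect_cube d X R' \<and> R' \<subseteq> P \<and> (\<forall>x\<in>R'. (n \<in> code (g x)) \<noteq> b)" for b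
    proof -
      obtain R where R: "perfect_cube d X R" "R \<subseteq> P"
        "\<not> (\<exists>R'. perfect_cube d X R' \<and> R' \<subseteq> R \<and> (\<forall>x\<in>R'. (n \<in> code (g x)) = b))"
        using neg by blast
      obtain R' where R': "perfect_cube d X R'" "R' \<subseteq> R" "R' \<subseteq> g -` ?A \<or> R' \<inter> g -` ?A = {}"
        using dec[of ?A] R(1,2) unfolding decides_def by blast
      then have "\<forall>x\<in>R'. (n \<in> code (g x)) \<noteq> b"
        using R(3) by (cases b) blast+
      then show ?thesis using R' R(2) by blast
    qed
    from this[of True] this[of False] obtain R0 R1 where
      "perfect_cube d X R0" "R0 \<subseteq> P" "\<forall>x\<in>R0. n \<notin> code (g x)"
      "perfect_cube d X R1" "R1 \<subseteq> P" "\<forall>x\<in>R1. n \<in> code (g x)" by auto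
    moreover from this have "g ` R0 \<inter> g ` R1 = {}" by auto
    ultimately show False using no that by blast
  qed
  then obtain b where b: "\<And>n R. perfect_cube d X R \<Longrightarrow> R \<subseteq> P \<Longrightarrow>
      \<exists>R'. perfect_cube d X R' \<and> R' \<subseteq> R \<and> (\<forall>x\<in>R'. (n \<in> code (g x)) = b n)"
    by metis
  obtain Q where Q: "perfect_cube d X Q" "Q \<subseteq> P" and
    bits: "\<And>n x. x \<in> Q \<Longrightarrow> \<exists>U. openin (cube_topology d X) U \<and> x \<in> U \<and>
        (\<forall>x\<in>Q \<inter> U. (n \<in> code (g x)) = b n)"
    by (rule fusion[OF P, of "\<lambda>n Z. \<forall>x\<in>Z. (n \<in> code (g x)) = b n"]) (use b in blast)+
  have "code (g x) = Collect b" if "x \<in> Q" for x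
    using bits[OF that] that by blast
  then have "g x = g y" if "x \<in> Q" "y \<in> Q" for x y
    using inj_onD[OF inj, of "g x" "g y"] that Q(2) by auto
  then have "\<exists>c. g ` Q \<subseteq> {c}" by blast
  then show False using nonconstant[OF Q] by blast
qed

lemma nested_cubes_nonempty:
  assumes F: "\<And>k. F (Suc k) \<preceq> F k" "F 0 \<preceq> F 0" and small: "\<And>k. small k (F (Suc k))"
  obtains x where "\<And>k. x \<in> Pi\<^sub>E I (F k)"
proof -
  have refl: "F k \<preceq> F k" for k
    using F refines_refl by (cases k) auto
  have "\<exists>z. \<forall>k. z \<in> F k m" if m: "m \<in> I" for m
  proof -
    interpret Metric_space "topspace (X m)" "\<delta> m" using metric m .
    have perf: "perfect_in (X m) (F k m)" for k using refl m unfolding refines_def by blast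
    show ?thesis
    proof (rule nested_closed_nonempty[of "\<lambda>k. F k m"])
      show "mcomplete" using complete m .
      show "closedin mtopology (F k m)" "F k m \<noteq> {}" for k
        using perf mtopology[OF m] unfolding perfect_in_def by auto
      show "F (Suc k) m \<subseteq> F k m" for k using F(1) m unfolding refines_def by blast
      fix e :: real assume "e > 0"
      then obtain k where k: "inverse (real (Suc k)) < e" using reals_Archimedean by blast
      have "inverse (real (Suc (max k m))) \<le> inverse (real (Suc k))"
        by (intro le_imp_inverse_le) auto
      then have bound: "inverse (real (Suc (max k m))) < e" using k by linarith
      have "\<delta> m x y < e" if "x \<in> F (Suc (max k m)) m" "y \<in> F (Suc (max k m)) m" for x y
        using small[of "max k m"] m that bound unfolding small_def by (meson less_trans max.cobounded2)
      then show "\<exists>k. \<forall>x\<in>F k m. \<forall>y\<in>F k m. \<delta> m x y < e"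
        by blast
    qed blast
  qed
  then obtain z where z: "\<And>m k. m \<in> I \<Longrightarrow> z m \<in> F k m" by metis
  then have "restrict z I \<in> Pi\<^sub>E I (F k)" for k by auto
  then show thesis using that by blast
qed

text \<open>
  Repeated splitting gives a binary tree of shrinking cubes with disjoint images at each
  branching; a point on each branch yields continuum many different values.
\<close>

lemma continuum_many_values:
  fixes g :: "(nat \<Rightarrow> 'a) \<Rightarrow> 'b"
  assumes P: "perfect_cube d X P"
    and split: "\<And>R. perfect_cube d X R \<Longrightarrow> R \<subseteq> P \<Longrightarrow> \<exists>A B. perfect_cube d X A \<and>
       perfect_cube d X B \<and> A \<subseteq> R \<and> B \<subseteq> R \<and> g ` A \<inter> g ` B = {}"
  shows "|UNIV :: nat set set| \<le>o |g ` P|"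
proof -
  obtain F0 where F0: "F0 \<preceq> F0" "P = Pi\<^sub>E I F0"
    using P unfolding perfect_cube_iff by blast
  have "\<exists>H. F \<preceq> F0 \<longrightarrow> (\<forall>b. H b \<preceq> F \<and> small n (H b)) \<and>
      g ` Pi\<^sub>E I (H True) \<inter> g ` Pi\<^sub>E I (H False) = {}" for F n
  proof (cases "F \<preceq> F0")
    case True
    then have "perfect_cube d X (Pi\<^sub>E I F)" "Pi\<^sub>E I F \<subseteq> P"
      unfolding perfect_cube_iff using refines_refl[OF True] refines_imp_subset[OF True] F0(2) by auto
    from split[OF this] obtain A B where AB: "perfect_cube d X A" "perfect_cube d X B"
      "A \<subseteq> Pi\<^sub>E I F" "B \<subseteq> Pi\<^sub>E I F" "g ` A \<inter> g ` B = {}" by blast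
    have shrink: "\<exists>H. H \<preceq> F \<and> small n H \<and> Pi\<^sub>E I H \<subseteq> C"
      if C: "perfect_cube d X C" "C \<subseteq> Pi\<^sub>E I F" for C
    proof -
      obtain F1 where F1: "F1 \<preceq> F1" "C = Pi\<^sub>E I F1" using C(1) unfolding perfect_cube_iff by blast
      obtain H where H: "H \<preceq> F1" "small n H" using small_refinement[OF F1(1)] by blast
      have "F1 \<preceq> F" using refines_iff_subset[OF F1(1)] C(2) F1(2) by simp
      then show ?thesis using H refines_trans[OF H(1)] refines_imp_subset[OF H(1)] F1(2) by blast
    qed
    obtain H1 where H1: "H1 \<preceq> F" "small n H1" "Pi\<^sub>E I H1 \<subseteq> A" using shrink AB by metis
    obtain H2 where H2: "H2 \<preceq> F" "small n H2" "Pi\<^sub>E I H2 \<subseteq> B" using shrink AB by metis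
    have "g ` Pi\<^sub>E I H1 \<inter> g ` Pi\<^sub>E I H2 = {}" using H1(3) H2(3) AB(5) by blast
    then show ?thesis using H1 H2 by (intro exI[of _ "\<lambda>b. if b then H1 else H2"]) simp
  qed simp
  then obtain H where H: "\<And>F n b. F \<preceq> F0 \<Longrightarrow> H F n b \<preceq> F \<and> small n (H F n b)"
    "\<And>F n. F \<preceq> F0 \<Longrightarrow> g ` Pi\<^sub>E I (H F n True) \<inter> g ` Pi\<^sub>E I (H F n False) = {}"
    by metis
  define C where "C S = rec_nat F0 (\<lambda>n F. H F n (n \<in> S))" for S
  have C_simps: "C S 0 = F0" "C S (Suc n) = H (C S n) n (n \<in> S)" for S n
    by (auto simp: C_def)
  have C_F0: "C S n \<preceq> F0" for S n
  proof (induction n)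
    case (Suc n)
    then show ?case using H(1)[OF Suc] refines_trans[OF _ Suc] by (auto simp: C_simps)
  qed (simp add: C_simps F0(1))
  have "\<exists>x. \<forall>k. x \<in> Pi\<^sub>E I (C S k)" for S
  proof -
    obtain x where "\<And>k. x \<in> Pi\<^sub>E I (C S k)"
      by (rule nested_cubes_nonempty[of "C S"]) (use C_F0 H(1) F0(1) in \<open>auto simp: C_simps\<close>)
    then show ?thesis by blast
  qed
  then obtain x where x: "\<And>S k. x S \<in> Pi\<^sub>E I (C S k)" by metis
  have diff: "g (x S) \<noteq> g (x S')" if "S \<noteq> S'" for S S'
  proof -
    have ex: "\<exists>n. (n \<in> S) \<noteq> (n \<in> S')" using that by blast
    define n where "n = (LEAST n. (n \<in> S) \<noteq> (n \<in> S'))"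
    have n: "(n \<in> S) \<noteq> (n \<in> S')" unfolding n_def using ex by (rule LeastI_ex)
    have "(k \<in> S) = (k \<in> S')" if "k < n" for k
      using not_less_Least that unfolding n_def by blast
    then have "C S k = C S' k" if "k \<le> n" for k
      using that by (induction k) (auto simp: C_simps)
    then have "C S n = C S' n" by simp
    then have "g ` Pi\<^sub>E I (C S (Suc n)) \<inter> g ` Pi\<^sub>E I (C S' (Suc n)) = {}"
      using H(2)[OF C_F0, of S n n] n unfolding C_simps by (cases "n \<in> S") auto
    then show ?thesis using x[of S "Suc n"] x[of S' "Suc n"] by blast
  qed
  have "inj (\<lambda>S. g (x S))" using diff by (auto simp: inj_def)
  moreover have "range (\<lambda>S. g (x S)) \<subseteq> g ` P" using x[of _ 0] F0(2) by (auto simp: C_simps)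
  ultimately show ?thesis using card_of_ordLeq by blast
qed

text \<open>
  With countable bases of the factors, a point is determined by the basic sets that contain its
  coordinates, and a cube by the basic open conditions on one coordinate that miss it, because
  its sides are closed. So there are at most continuum many points and perfect cubes.
\<close>

lemma coding:
  assumes sep: "\<And>m. m \<in> I \<Longrightarrow> separable_space (X m)"
  obtains point_code :: "(nat \<Rightarrow> 'a) \<Rightarrow> nat set" and cube_code :: "(nat \<Rightarrow> 'a) set \<Rightarrow> nat set"
  where "inj_on point_code (topspace (cube_topology d X))"
    "inj_on cube_code {R. perfect_cube d X R}"
proof -
  have "\<exists>B :: nat \<Rightarrow> 'a set. (\<forall>n. openin (X m) (B n)) \<and>
      (\<forall>U x. openin (X m) U \<and> x \<in> U \<longrightarrow> (\<exists>n. x \<in> B n \<and> B n \<subseteq> U))" if m: "m \<in> I" for m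
  proof -
    have "metrizable_space (X m)" using metric[OF m] mtopology[OF m] metrizable_space_def by metis
    then show ?thesis using separable_metrizable_countable_base sep[OF m] by metis
  qed
  then obtain B where B: "\<And>m n. m \<in> I \<Longrightarrow> openin (X m) (B m n)"
    "\<And>m U x. m \<in> I \<Longrightarrow> openin (X m) U \<Longrightarrow> x \<in> U \<Longrightarrow> \<exists>n :: nat. x \<in> B m n \<and> B m n \<subseteq> U"
    by metis
  define point_code where "point_code x = {prod_encode (m, n) | m n. m \<in> I \<and> x m \<in> B m n}"
    for x :: "nat \<Rightarrow> 'a"
  define cube_code where
    "cube_code R = {prod_encode (m, n) | m n. m \<in> I \<and> R \<inter> {x. x m \<in> B m n} = {}}"
    for R :: "(nat \<Rightarrow> 'a) set"
  have "inj_on point_code (topspace (cube_topology d X))"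
  proof (rule inj_onI)
    fix x y
    assume xy: "x \<in> topspace (cube_topology d X)" "y \<in> topspace (cube_topology d X)"
      and eq: "point_code x = point_code y"
    have x: "x \<in> Pi\<^sub>E I (\<lambda>m. topspace (X m))" and y: "y \<in> Pi\<^sub>E I (\<lambda>m. topspace (X m))"
      using xy unfolding cube_topology_def by auto
    show "x = y"
    proof (rule PiE_ext[OF x y])
      fix m assume m: "m \<in> I"
      interpret Metric_space "topspace (X m)" "\<delta> m" using metric m .
      show "x m = y m"
      proof (rule ccontr)
        assume ne: "x m \<noteq> y m"
        have "x m \<in> topspace (X m)" "y m \<in> topspace (X m)" using x y m by auto
        then obtain U where U: "openin (X m) U" "x m \<in> U" "y m \<notin> U"
          using ne Hausdorff_space_mtopology unfolding mtopology[OF m] Hausdorff_space_def disjnt_iff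
          by metis
        obtain n where "x m \<in> B m n" "B m n \<subseteq> U" using B(2)[OF m U(1,2)] by blast
        then have "prod_encode (m, n) \<in> point_code x" "prod_encode (m, n) \<notin> point_code y"
          using m U(3) unfolding point_code_def by auto
        then show False using eq by simp
      qed
    qed
  qed
  moreover have "inj_on cube_code {R. perfect_cube d X R}"
  proof (rule inj_onI, unfold mem_Collect_eq)
    have sub: "F m \<subseteq> F' m"
      if F: "F \<preceq> F" "F' \<preceq> F'" and eq: "cube_code (Pi\<^sub>E I F) = cube_code (Pi\<^sub>E I F')" and m: "m \<in> I"
      for F F' m
    proof
      fix a assume a: "a \<in> F m"
      have perf: "perfect_in (X m) (F' m)" "perfect_in (X m) (F m)"
        using F m unfolding refines_def by blast+
      obtain z where z: "z \<in> Pi\<^sub>E I F"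
        using perfect_cube_nonempty F(1) unfolding perfect_cube_iff by blast
      \<comment> \<open>Every point of the side \<open>F m\<close> is a coordinate of a point of the cube.\<close>
      have za: "z(m := a) \<in> Pi\<^sub>E I F" using z a m by (auto simp: PiE_iff extensional_def)
      show "a \<in> F' m"
      proof (rule ccontr)
        assume "a \<notin> F' m"
        then have "a \<in> topspace (X m) - F' m" using a perfect_in_subset_topspace[OF perf(2)] by blast
        moreover have "openin (X m) (topspace (X m) - F' m)"
          using perf(1) unfolding perfect_in_def by blast
        ultimately obtain n where n: "a \<in> B m n" "B m n \<subseteq> topspace (X m) - F' m"
          using B(2)[OF m] by metis
        have "Pi\<^sub>E I F' \<inter> {x. x m \<in> B m n} = {}" using n(2) m by auto
        then have "prod_encode (m, n) \<in> cube_code (Pi\<^sub>E I F')" using m unfolding cube_code_def by blast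
        then have "prod_encode (m, n) \<in> cube_code (Pi\<^sub>E I F)" using eq by simp
        then have "Pi\<^sub>E I F \<inter> {x. x m \<in> B m n} = {}" unfolding cube_code_def by auto
        then show False using za n(1) by auto
      qed
    qed
    fix R R' assume R: "perfect_cube d X R" "perfect_cube d X R'" and eq: "cube_code R = cube_code R'"
    obtain F where F: "F \<preceq> F" "R = Pi\<^sub>E I F" using R(1) unfolding perfect_cube_iff by blast
    obtain F' where F': "F' \<preceq> F'" "R' = Pi\<^sub>E I F'" using R(2) unfolding perfect_cube_iff by blast
    have "F m = F' m" if "m \<in> I" for m
      using sub[OF F(1) F'(1) _ that] sub[OF F'(1) F(1) _ that] eq F(2) F'(2) by auto
    then show "R = R'" using F(2) F'(2) by (auto intro: PiE_cong)
  qed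
  ultimately show thesis using that by blast
qed

text \<open>
  This replaces the separability of the range. If \<open>g\<close> were constant on no subcube, its image of
  every subcube would have continuum many points. Since there are only continuum many cubes,
  some set \<open>A\<close> of values meets each of these images without including it, and then no subcube
  is contained in or disjoint from the preimage of \<open>A\<close>.
\<close>

theorem constant_on_subcube:
  fixes g :: "(nat \<Rightarrow> 'a) \<Rightarrow> 'b"
  assumes sep: "\<And>m. m \<in> I \<Longrightarrow> separable_space (X m)"
    and P: "perfect_cube d X P" and dec: "\<And>A. decides P (g -` A)"
  obtains Q c where "perfect_cube d X Q" "Q \<subseteq> P" "g ` Q \<subseteq> {c}"
proof (rule ccontr)
  note witness = that
  assume no: "\<not> thesis"
  have nonconstant: "\<not> g ` R \<subseteq> {c}" if R: "perfect_cube d X R" "R \<subseteq> P" for R c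
    using witness R no by blast
  obtain point_code :: "(nat \<Rightarrow> 'a) \<Rightarrow> nat set" and cube_code :: "(nat \<Rightarrow> 'a) set \<Rightarrow> nat set" where
    pc: "inj_on point_code (topspace (cube_topology d X))" and
    cc: "inj_on cube_code {R. perfect_cube d X R}"
    using coding sep by blast
  define code where "code y = point_code (inv_into P g y)" for y
  have code: "inj_on code (g ` P)"
  proof (rule inj_onI)
    fix y z assume yz: "y \<in> g ` P" "z \<in> g ` P" "code y = code z"
    then have "inv_into P g y = inv_into P g z"
      using pc perfect_cube_subset_topspace[OF P] inv_into_into unfolding code_def inj_on_def
      by (metis subsetD)
    then show "y = z" using yz by (metis f_inv_into_f)
  qed
  have large: "|UNIV :: nat set set| \<le>o |g ` R|" if R: "perfect_cube d X R" "R \<subseteq> P" for R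
  proof (rule continuum_many_values[OF R(1)])
    fix S assume S: "perfect_cube d X S" "S \<subseteq> R"
    have SP: "S \<subseteq> P" using S R by blast
    have "inj_on code (g ` S)" using code SP by (meson image_mono inj_on_subset)
    then obtain A B where "perfect_cube d X A" "perfect_cube d X B" "A \<subseteq> S" "B \<subseteq> S" "g ` A \<inter> g ` B = {}"
      by (rule cube_split_values[OF S(1), where g = g])
        (use decides_mono[OF dec SP] nonconstant SP in auto)
    then show "\<exists>A B. perfect_cube d X A \<and> perfect_cube d X B \<and> A \<subseteq> S \<and> B \<subseteq> S \<and> g ` A \<inter> g ` B = {}"
      by blast
  qed
  \<comment> \<open>The Bernstein construction wants the cubes indexed by all sets of naturals; unused codes are sent to \<open>P\<close>.\<close>
  define sel where "sel S = (if \<exists>R. perfect_cube d X R \<and> R \<subseteq> P \<and> cube_code R = S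
      then SOME R. perfect_cube d X R \<and> R \<subseteq> P \<and> cube_code R = S else P)" for S
  have sel: "perfect_cube d X (sel S) \<and> sel S \<subseteq> P" for S
  proof (cases "\<exists>R. perfect_cube d X R \<and> R \<subseteq> P \<and> cube_code R = S")
    case True
    then show ?thesis using someI_ex[OF True] unfolding sel_def by simp
  next
    case False
    then show ?thesis using P unfolding sel_def by auto
  qed
  have sel_code: "sel (cube_code R) = R" if R: "perfect_cube d X R" "R \<subseteq> P" for R
  proof -
    have ex: "\<exists>R'. perfect_cube d X R' \<and> R' \<subseteq> P \<and> cube_code R' = cube_code R" using R by blast
    then have "cube_code (sel (cube_code R)) = cube_code R"
      using someI_ex[OF ex] unfolding sel_def by simp
    then show ?thesis using cc sel R unfolding inj_on_def by blast
  qed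
  have "infinite (UNIV :: nat set set)" by (simp add: Finite_Set.finite_set)
  then obtain A where A: "\<And>S :: nat set. g ` sel S \<inter> A \<noteq> {}" "\<And>S :: nat set. \<not> g ` sel S \<subseteq> A"
    using bernstein_set[of "\<lambda>S :: nat set. g ` sel S"] large sel by blast
  obtain R where R: "perfect_cube d X R" "R \<subseteq> P" "R \<subseteq> g -` A \<or> R \<inter> g -` A = {}"
    using dec[of A] P unfolding decides_def by blast
  then show False using A[of "cube_code R"] sel_code[OF R(1,2)] by auto
qed

end

section \<open>Continuity on a subcube\<close>

text \<open>
  The combinatorial core of Stone's theorem that metric spaces are paracompact, in the form of
  M. E. Rudin's proof. Assign each point to the least centre \<open>y\<close> whose \<open>e\<close>-ball contains it, and
  keep at stage \<open>n\<close> the points that lie deep inside that ball. Points assigned to different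
  centres are then at least three gaps apart, so their neighbourhoods of radius one gap do not
  meet.
\<close>

lemma (in Metric_space) sigma_discrete_cover:
  assumes e: "e > 0"
  obtains E :: "nat \<Rightarrow> 'a \<Rightarrow> 'a set" where
    "\<And>n y. openin mtopology (E n y)" "\<And>n y. E n y \<subseteq> mball y e"
    "\<And>n y z. y \<noteq> z \<Longrightarrow> E n y \<inter> E n z = {}" "M \<subseteq> (\<Union>n. \<Union>y\<in>M. E n y)"
proof -
  obtain r :: "'a rel" where r: "well_order r" using well_order_on[of UNIV] by blast
  then have wf: "wf (r - Id)" and tot: "\<And>y z. y \<noteq> z \<Longrightarrow> (y, z) \<in> r - Id \<or> (z, y) \<in> r - Id"
    unfolding well_order_on_def linear_order_on_def total_on_def by auto
  define gap where "gap n = inverse (real (Suc n))" for n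
  define S where "S n y = {x \<in> M. mball x (3 * gap n) \<subseteq> mball y e \<and>
      (\<forall>z. (z, y) \<in> r - Id \<longrightarrow> x \<notin> mball z e)}" for n y
  define E where "E n y = (\<Union>x\<in>S n y. mball x (gap n))" for n y
  have gap: "gap n > 0" for n unfolding gap_def by simp
  have far: "E n y \<inter> E n z = {}" if yz: "(y, z) \<in> r - Id" for n y z
  proof (rule ccontr)
    assume "\<not> ?thesis"
    then obtain w x x' where x: "x \<in> S n y" "w \<in> mball x (gap n)"
      and x': "x' \<in> S n z" "w \<in> mball x' (gap n)" unfolding E_def by blast
    then have M: "x \<in> M" "w \<in> M" "x' \<in> M" "d x w < gap n" "d x' w < gap n" by auto
    then have "d x x' < 3 * gap n" using triangle[of x w x'] commute[of x' w] gap[of n] by linarith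
    then have "x' \<in> mball y e" using x(1) M unfolding S_def by force
    then show False using x'(1) yz unfolding S_def by blast
  qed
  have cover: "\<exists>n y. y \<in> M \<and> x \<in> E n y" if x: "x \<in> M" for x
  proof -
    have "x \<in> {y. x \<in> mball y e}" using x e by simp
    then have "\<exists>y\<in>{y. x \<in> mball y e}. \<forall>z. (z, y) \<in> r - Id \<longrightarrow> z \<notin> {y. x \<in> mball y e}"
      using wf unfolding wf_eq_minimal by (elim allE impE)
    then obtain y where y: "x \<in> mball y e" and least: "\<And>z. (z, y) \<in> r - Id \<Longrightarrow> x \<notin> mball z e"
      by auto
    from y have xy: "d y x < e" "y \<in> M" by auto
    obtain n where n: "gap n < (e - d y x) / 3"
      using reals_Archimedean[of "(e - d y x) / 3"] xy(1) unfolding gap_def by auto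
    have "mball x (3 * gap n) \<subseteq> mball y e"
    proof
      fix z assume "z \<in> mball x (3 * gap n)"
      then have "z \<in> M" "d x z < 3 * gap n" by auto
      then show "z \<in> mball y e" using triangle[of y x z] x xy n by simp
    qed
    then have "x \<in> S n y" using least x unfolding S_def by blast
    then show ?thesis using x gap[of n] xy(2) unfolding E_def by (metis UN_I centre_in_mball_iff)
  qed
  show thesis
  proof (rule that[of E])
    show "openin mtopology (E n y)" for n y
      unfolding E_def by (intro openin_Union) auto
    show "E n y \<subseteq> mball y e" for n y
    proof
      fix w assume "w \<in> E n y"
      then obtain x where x: "x \<in> S n y" "w \<in> mball x (gap n)" unfolding E_def by blast
      then have "w \<in> mball x (3 * gap n)" using gap[of n] by auto
      then show "w \<in> mball y e" using x(1) unfolding S_def by blast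
    qed
    show "E n y \<inter> E n z = {}" if "y \<noteq> z" for n y z
      using far[of y z n] far[of z y n] tot[OF that] by blast
    show "M \<subseteq> (\<Union>n. \<Union>y\<in>M. E n y)" using cover by blast
  qed
qed

context complete_factors
begin

lemma decides_cong_on:
  assumes "decides P A" "A \<inter> P = B \<inter> P" shows "decides P B"
  unfolding decides_def
proof (intro allI impI)
  fix R assume "perfect_cube d X R \<and> R \<subseteq> P"
  moreover from this obtain R' where "perfect_cube d X R'" "R' \<subseteq> R" "R' \<subseteq> A \<or> R' \<inter> A = {}"
    using assms(1) unfolding decides_def by blast
  ultimately have "perfect_cube d X R' \<and> R' \<subseteq> R \<and> (R' \<subseteq> B \<or> R' \<inter> B = {})"
    using assms(2) by blast
  then show "\<exists>R'. perfect_cube d X R' \<and> R' \<subseteq> R \<and> (R' \<subseteq> B \<or> R' \<inter> B = {})" by blast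
qed

text \<open>
  Some layer \<open>n\<close> of the cover of \<open>Y\<close> by small sets has a preimage that contains a cube. Within
  this layer the sets \<open>E n y\<close> are disjoint and all their unions are open. Hence the map \<open>g\<close> that
  names the set in which \<open>f x\<close> lies has all its preimages decided, and is constant on a
  subcube.
\<close>

lemma small_image_subcube:
  fixes f :: "(nat \<Rightarrow> 'a) \<Rightarrow> 'b"
  assumes sep: "\<And>m. m \<in> I \<Longrightarrow> separable_space (X m)"
    and Y: "Metric_space Y \<rho>" and e: "e > 0"
    and P: "perfect_cube d X P" and fP: "f ` P \<subseteq> Y"
    and dec: "\<And>U. openin (Metric_space.mtopology Y \<rho>) U \<Longrightarrow> decides P (f -` U)"
  obtains Q c where "perfect_cube d X Q" "Q \<subseteq> P" "f ` Q \<subseteq> Metric_space.mball Y \<rho> c e"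
proof -
  interpret Y: Metric_space Y \<rho> using Y .
  obtain E where E: "\<And>n y. openin Y.mtopology (E n y)" "\<And>n y. E n y \<subseteq> Y.mball y e"
    "\<And>n y z. y \<noteq> z \<Longrightarrow> E n y \<inter> E n z = {}" "Y \<subseteq> (\<Union>n :: nat. \<Union>y\<in>Y. E n y)"
    using Y.sigma_discrete_cover[OF e] by blast
  have E_union: "openin Y.mtopology (\<Union>y\<in>A. E n y)" for n A
    using E(1) by (intro openin_Union) auto
  have "decides P (f -` (\<Union>y\<in>Y. E n y))" for n using dec[OF E_union] .
  moreover have "P \<subseteq> (\<Union>n. f -` (\<Union>y\<in>Y. E n y))"
  proof
    fix x assume "x \<in> P"
    then have "f x \<in> Y" using fP by blast
    then have "f x \<in> (\<Union>n. \<Union>y\<in>Y. E n y)" by (rule subsetD[OF E(4)])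
    then show "x \<in> (\<Union>n. f -` (\<Union>y\<in>Y. E n y))" by simp
  qed
  ultimately obtain n R where R: "perfect_cube d X R" "R \<subseteq> P" "R \<subseteq> f -` (\<Union>y\<in>Y. E n y)"
    by (rule countable_cover_contains_cube[OF P])
  define g where "g x = (THE y. f x \<in> E n y)" for x
  have g_eq: "g x = y" if "f x \<in> E n y" for x y
    unfolding g_def using that E(3)[of _ y n] by (intro the_equality) blast+
  have g_mem: "f x \<in> E n (g x)" if x: "x \<in> R" for x
  proof -
    obtain y where "f x \<in> E n y" using R(3) x by blast
    then show ?thesis using g_eq by metis
  qed
  have "decides R (g -` A)" for A
  proof (rule decides_cong_on)
    show "decides R (f -` (\<Union>y\<in>A. E n y))" using decides_mono[OF dec[OF E_union] R(2)] .
    show "f -` (\<Union>y\<in>A. E n y) \<inter> R = g -` A \<inter> R"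
    proof (intro equalityI subsetI)
      fix x assume "x \<in> f -` (\<Union>y\<in>A. E n y) \<inter> R"
      then show "x \<in> g -` A \<inter> R" using g_eq by auto
    next
      fix x assume "x \<in> g -` A \<inter> R"
      then show "x \<in> f -` (\<Union>y\<in>A. E n y) \<inter> R" using g_mem[of x] by blast
    qed
  qed
  then obtain Q c where Q: "perfect_cube d X Q" "Q \<subseteq> R" "g ` Q \<subseteq> {c}"
    using constant_on_subcube[OF sep R(1)] by blast
  have "f ` Q \<subseteq> E n c" using Q(2,3) g_mem by blast
  then have "f ` Q \<subseteq> Y.mball c e" using E(2) by blast
  then show thesis using that[OF Q(1)] Q(2) R(2) by blast
qed

text \<open>
  Fusion applied to the properties that \<open>f\<close> maps the set into a ball of radius \<open>1 / (n + 1)\<close>: on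
  the resulting cube these properties hold locally for every \<open>n\<close>, which is continuity.
\<close>

theorem continuous_on_subcube:
  fixes f :: "(nat \<Rightarrow> 'a) \<Rightarrow> 'b"
  assumes sep: "\<And>m. m \<in> I \<Longrightarrow> separable_space (X m)"
    and Y: "Metric_space Y \<rho>"
    and P: "perfect_cube d X P" and fP: "f ` P \<subseteq> Y"
    and dec: "\<And>U. openin (Metric_space.mtopology Y \<rho>) U \<Longrightarrow> decides P (f -` U)"
  obtains Q where "perfect_cube d X Q" "Q \<subseteq> P"
    "continuous_map (subtopology (cube_topology d X) Q) (Metric_space.mtopology Y \<rho>) f"
proof -
  interpret Y: Metric_space Y \<rho> using Y .
  define D where "D n Z \<longleftrightarrow> (\<exists>c. f ` Z \<subseteq> Y.mball c (inverse (real (Suc n))))"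
    for n :: nat and Z :: "(nat \<Rightarrow> 'a) set"
  have dense: "\<exists>R'. perfect_cube d X R' \<and> R' \<subseteq> R \<and> D n R'"
    if R: "perfect_cube d X R" "R \<subseteq> P" for n R
  proof -
    have pos: "inverse (real (Suc n)) > 0" by simp
    have fR: "f ` R \<subseteq> Y" using fP R(2) by blast
    obtain Q c where "perfect_cube d X Q" "Q \<subseteq> R" "f ` Q \<subseteq> Y.mball c (inverse (real (Suc n)))"
      by (rule small_image_subcube[OF sep Y pos R(1) fR decides_mono[OF dec R(2)]])
    then show ?thesis unfolding D_def by blast
  qed
  have hereditary: "D n Z'" if "Z' \<subseteq> Z" "D n Z" for n Z Z'
    using that unfolding D_def by blast
  obtain Q where Q: "perfect_cube d X Q" "Q \<subseteq> P" and
    loc: "\<And>n x. x \<in> Q \<Longrightarrow> \<exists>U. openin (cube_topology d X) U \<and> x \<in> U \<and> D n (Q \<inter> U)"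
    by (rule fusion[where D = D, OF P dense hereditary]) blast+
  have "continuous_map (subtopology (cube_topology d X) Q) Y.mtopology f"
    unfolding Y.continuous_map_to_metric
  proof (intro ballI allI impI)
    fix x and e :: real
    assume "x \<in> topspace (subtopology (cube_topology d X) Q)" and e: "e > 0"
    then have x: "x \<in> Q" by simp
    obtain n where n: "inverse (real (Suc n)) < e / 2"
      using reals_Archimedean[of "e / 2"] e by auto
    obtain U c where U: "openin (cube_topology d X) U" "x \<in> U"
      and c: "f ` (Q \<inter> U) \<subseteq> Y.mball c (inverse (real (Suc n)))"
      using loc[OF x, of n] unfolding D_def by blast
    have "f y \<in> Y.mball (f x) e" if y: "y \<in> Q \<inter> U" for y
    proof -
      have "f x \<in> Y.mball c (inverse (real (Suc n)))" "f y \<in> Y.mball c (inverse (real (Suc n)))"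
        using c x U(2) y by blast+
      then have "c \<in> Y" "f x \<in> Y" "f y \<in> Y" "\<rho> c (f x) < e / 2" "\<rho> c (f y) < e / 2"
        using n by auto
      then show ?thesis
        using Y.triangle[of "f x" c "f y"] Y.commute[of c "f x"] by simp
    qed
    moreover have "openin (subtopology (cube_topology d X) Q) (Q \<inter> U)"
      using U(1) by (simp add: openin_subtopology_Int2)
    ultimately show "\<exists>U. openin (subtopology (cube_topology d X) Q) U \<and> x \<in> U \<and>
        (\<forall>y\<in>U. f y \<in> Y.mball (f x) e)"
      using x U(2) by blast
  qed
  then show thesis using that Q by blast
qed

end

theorem theorem3:
  fixes d :: enat
    and X :: "nat \<Rightarrow> 'a topology"
    and Y :: "'b set" and dist_Y :: "'b \<Rightarrow> 'b \<Rightarrow> real"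
    and f :: "(nat \<Rightarrow> 'a) \<Rightarrow> 'b"
    and P :: "(nat \<Rightarrow> 'a) set"
  assumes "\<And>m. m \<in> index_set d \<Longrightarrow> Polish_space (X m)"
    and "\<And>m. m \<in> index_set d \<Longrightarrow> dense_in_itself (X m)"
    and "Metric_space Y dist_Y"
    and "s_measurable d X (Metric_space.mtopology Y dist_Y) f"
    and "perfect_cube d X P"
  shows "\<exists>Q. perfect_cube d X Q \<and> Q \<subseteq> P \<and>
           continuous_map (subtopology (cube_topology d X) Q)
             (Metric_space.mtopology Y dist_Y) f"
proof -
  interpret Y: Metric_space Y dist_Y using assms(3) .
  have "\<exists>\<rho>. Metric_space (topspace (X m)) \<rho> \<and> Metric_space.mtopology (topspace (X m)) \<rho> = X m \<and>
      Metric_space.mcomplete (topspace (X m)) \<rho>" if "m \<in> index_set d" for m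
    using assms(1)[OF that] Metric_space.topspace_mtopology
    unfolding Polish_space_def completely_metrizable_space_def by metis
  then obtain \<delta> where \<delta>: "\<And>m. m \<in> index_set d \<Longrightarrow> Metric_space (topspace (X m)) (\<delta> m) \<and>
      Metric_space.mtopology (topspace (X m)) (\<delta> m) = X m \<and>
      Metric_space.mcomplete (topspace (X m)) (\<delta> m)" by metis
  interpret complete_factors d X \<delta> by (rule complete_factors.intro) (use \<delta> in blast)+
  have PX: "P \<subseteq> topspace (cube_topology d X)"
    using assms(5) by (rule perfect_cube_subset_topspace)
  have fP: "f ` P \<subseteq> Y" using assms(4) PX unfolding s_measurable_def by auto
  have dec: "decides P (f -` U)" if "openin Y.mtopology U" for U
  proof (rule decides_cong_on)
    let ?A = "{x \<in> topspace (cube_topology d X). f x \<in> U}"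
    have "?A \<in> s_sets d X" using assms(4) that unfolding s_measurable_def by blast
    then show "decides P ?A" unfolding decides_def s_sets_def by blast
    show "?A \<inter> P = f -` U \<inter> P" using PX by auto
  qed
  have sep: "separable_space (X m)" if "m \<in> index_set d" for m
    using assms(1)[OF that] unfolding Polish_space_def by blast
  obtain Q where "perfect_cube d X Q" "Q \<subseteq> P"
    "continuous_map (subtopology (cube_topology d X) Q) Y.mtopology f"
    by (rule continuous_on_subcube[OF sep assms(3) assms(5) fP dec])
  then show ?thesis by blast
qed

end
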